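(* Let $G$ be a finite simple graph with $\Delta(G) \ge 3$ such that the set of vertices of degree at least $3$ is an independent set in $G$. Then $\chi_a'(G) = \Delta(G)$.
   Context: An acyclic edge coloring of a graph is a proper edge coloring with no cycle whose edges use only two colors (equivalently, any two color classes induce a linear forest). The acyclic chromatic index $\chi_a'(G)$ is the least number of colors in an acyclic edge coloring of $G$. $\Delta(G)$ is the maximum degree of $G$. *)

theory Defs
  imports Main
begin

text \<open>A graph is a vertex set \<open>V\<close> together with a set \<open>E\<close> of undirected edges; an edge is the
  two-element set of its end vertices, so loops and parallel edges cannot occur.\<close>

definition finite_simple_graph :: "'a set \<Rightarrow> 'a set set \<Rightarrow> bool" where
  "finite_simple_graph V E \<longleftrightarrow> finite V \<and> (\<forall>e\<in>E. e \<subseteq> V \<and> card e = 2)"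

definition degree :: "'a set set \<Rightarrow> 'a \<Rightarrow> nat" where
  "degree E v = card {e \<in> E. v \<in> e}"

(* Inserting 0 only matters for the graph without vertices, where Max would be unspecified. *)
definition max_degree :: "'a set \<Rightarrow> 'a set set \<Rightarrow> nat" where
  "max_degree V E = Max (insert 0 (degree E ` V))"

definition independent_set :: "'a set \<Rightarrow> 'a set set \<Rightarrow> 'a set \<Rightarrow> bool" where
  "independent_set V E S \<longleftrightarrow> S \<subseteq> V \<and> (\<forall>u\<in>S. \<forall>v\<in>S. {u, v} \<notin> E)"

text \<open>A cycle is given by the list of its distinct vertices in cyclic order, the first vertex not
  being repeated at the end.\<close>

definition cycle_edges :: "'a list \<Rightarrow> 'a set set" where
  "cycle_edges p = {{p ! i, p ! (Suc i mod length p)} | i. i < length p}"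

definition is_cycle :: "'a set set \<Rightarrow> 'a list \<Rightarrow> bool" where
  "is_cycle E p \<longleftrightarrow> 3 \<le> length p \<and> distinct p \<and> cycle_edges p \<subseteq> E"

definition proper_edge_coloring :: "'a set set \<Rightarrow> ('a set \<Rightarrow> nat) \<Rightarrow> bool" where
  "proper_edge_coloring E c \<longleftrightarrow> (\<forall>e\<in>E. \<forall>f\<in>E. e \<noteq> f \<and> e \<inter> f \<noteq> {} \<longrightarrow> c e \<noteq> c f)"

definition acyclic_edge_coloring :: "'a set set \<Rightarrow> ('a set \<Rightarrow> nat) \<Rightarrow> bool" where
  "acyclic_edge_coloring E c \<longleftrightarrow>
     proper_edge_coloring E c \<and> \<not> (\<exists>p. is_cycle E p \<and> card (c ` cycle_edges p) \<le> 2)"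

(* For finite E the set of admissible k is nonempty: an injective c is acyclic, since a cycle has
   at least three edges. *)
definition acyclic_chromatic_index :: "'a set set \<Rightarrow> nat" where
  "acyclic_chromatic_index E = (LEAST k. \<exists>c. acyclic_edge_coloring E c \<and> c ` E \<subseteq> {..<k})"

end

theory Submission
  imports Defs
begin

text \<open>Only \<open>\<chi>'\<^sub>a \<le> k\<close> for \<open>k \<ge> 3\<close>, \<open>k \<ge> \<Delta>\<close> needs work; induct on the number of edges. Let \<open>e = uv\<close> be
  the only uncolored edge, where \<open>v\<close> has degree 2 and its other edge has color \<open>a\<close>.

  Suppose \<open>a\<close> is missing at \<open>u\<close> and the coloring does not extend. Then \<open>u\<close> sees every other color,
  and each neighbor \<open>y\<close> of \<open>u\<close> has a second edge, which has color \<open>a\<close>: if that edge had a color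
  \<open>d \<noteq> a\<close>, one could shift the colors of two or three edges at \<open>u\<close>, using that an
  \<open>a\<close>-\<open>d\<close>-path from \<open>u\<close> ends in only one place. Now the uncolored edge can be pushed from \<open>u\<close>
  through \<open>y\<close> to the vertex behind \<open>y\<close>, without ever turning back. The color \<open>a\<close> occurs only once
  at a vertex, so this walk never returns to an old vertex, which is impossible in a finite graph.

  If \<open>a\<close> is present at \<open>u\<close> and \<open>u\<close> has degree at least 3, recoloring a second edge at \<open>u\<close>
  either extends the coloring or leads to the first case. If all degrees are at most 2, some third
  color is free for \<open>e\<close>.\<close>

section \<open>Alternating edge sets\<close>

text \<open>Alternating sets of edges take the place of the two-colored cycles; no cycle has to be traced.\<close>

definition alternating :: "('a set \<Rightarrow> nat) \<Rightarrow> nat \<Rightarrow> nat \<Rightarrow> 'a set set \<Rightarrow> bool" where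
  "alternating c a b C \<longleftrightarrow>
     C \<noteq> {} \<and> c ` C \<subseteq> {a, b} \<and> (\<forall>e\<in>C. \<forall>x\<in>e. \<exists>f\<in>C. f \<noteq> e \<and> x \<in> f)"

definition alternating_free :: "'a set set \<Rightarrow> ('a set \<Rightarrow> nat) \<Rightarrow> bool" where
  "alternating_free E c \<longleftrightarrow> proper_edge_coloring E c \<and> \<not> (\<exists>C a b. C \<subseteq> E \<and> alternating c a b C)"

text \<open>In a simple graph: \<open>e = uy\<close>, the vertex \<open>y\<close> has degree 2, and \<open>g\<close> is its other edge.\<close>

definition far :: "'a set set \<Rightarrow> 'a \<Rightarrow> 'a set \<Rightarrow> 'a set \<Rightarrow> bool" where
  "far E u e g \<longleftrightarrow> e \<in> E \<and> g \<in> E \<and> u \<in> e \<and> u \<notin> g \<and> e \<inter> g \<noteq> {} \<and>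
     (\<forall>f\<in>E. u \<notin> f \<and> e \<inter> f \<noteq> {} \<longrightarrow> f = g)"

definition colorable :: "'a set set \<Rightarrow> nat \<Rightarrow> bool" where
  "colorable E k \<longleftrightarrow> (\<exists>c. alternating_free E c \<and> c ` E \<subseteq> {..<k})"

lemma properD:
  assumes "proper_edge_coloring E c" "e \<in> E" "f \<in> E" "x \<in> e" "x \<in> f" "c e = c f"
  shows "e = f"
  using assms unfolding proper_edge_coloring_def by blast

lemma alternating_other:
  assumes "proper_edge_coloring E c" "C \<subseteq> E" "alternating c a b C" "e \<in> C" "x \<in> e"
  obtains f where "f \<in> C" "f \<noteq> e" "x \<in> f" "c f \<noteq> c e" "{a, b} = {c e, c f}"
proof -
  obtain f where f: "f \<in> C" "f \<noteq> e" "x \<in> f"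
    using assms unfolding alternating_def by blast
  have ne: "c f \<noteq> c e"
    using properD[OF assms(1), of f e x] f assms by blast
  have "c e \<in> {a, b}" "c f \<in> {a, b}"
    using f assms unfolding alternating_def by blast+
  then have "{a, b} = {c e, c f}" using ne by auto
  then show ?thesis using that f ne by blast
qed

text \<open>Two edges at \<open>x\<close> already use both colors, so a third would repeat one. Thus
  an alternating set has degree exactly 2 at each vertex it touches.\<close>

lemma alternating_star:
  assumes p: "proper_edge_coloring E c" and "C \<subseteq> E" "alternating c a b C"
    and "e \<in> C" "x \<in> e" "f \<in> C" "x \<in> f" "f \<noteq> e"
  shows "{h \<in> C. x \<in> h} = {e, f}"
proof -
  have "c f \<noteq> c e"
    using properD[OF p, of f e x] assms by blast
  moreover have "c h \<in> {a, b}" if "h \<in> C" for h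
    using assms(3) that unfolding alternating_def by blast
  ultimately have "c h = c e \<or> c h = c f" if "h \<in> C" for h
    using that assms(4,6) by (metis insert_iff singletonD)
  then have "h = e \<or> h = f" if "h \<in> C" "x \<in> h" for h
    using that properD[OF p, of h e x] properD[OF p, of h f x] assms by blast
  then show ?thesis using assms(4-7) by auto
qed

lemma alternating_two_colors:
  assumes "alternating c a b C" "e \<in> C" "f \<in> C" "g \<in> C" "c e \<noteq> c f"
  shows "c g = c e \<or> c g = c f"
proof -
  have "c e \<in> {a, b}" "c f \<in> {a, b}" "c g \<in> {a, b}"
    using assms unfolding alternating_def by blast+
  then show ?thesis using assms(5) by auto
qed

section \<open>A parity argument\<close>

text \<open>Handshake argument: the degrees in \<open>Z\<close> sum to twice the number of edges, so
  there cannot be just one vertex of odd degree.\<close>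

lemma even_degree_rest:
  assumes "finite Z" and two: "\<forall>e\<in>Z. card e = 2"
    and ev: "\<And>x. x \<noteq> u \<Longrightarrow> even (card {e \<in> Z. x \<in> e})"
  shows "even (card {e \<in> Z. u \<in> e})"
proof -
  let ?V = "insert u (\<Union> Z)"
  have fin: "finite e" if "e \<in> Z" for e
    using two that card.infinite by fastforce
  then have fV: "finite ?V" using assms(1) by blast
  have "(\<Sum>x\<in>?V. card {e \<in> Z. x \<in> e}) = (\<Sum>x\<in>?V. \<Sum>e\<in>Z. if x \<in> e then 1 else 0)"
    using assms(1) by (simp add: sum.If_cases Int_def)
  also have "\<dots> = (\<Sum>e\<in>Z. \<Sum>x\<in>?V. if x \<in> e then 1 else 0)"
    by (rule sum.swap)
  also have "\<dots> = (\<Sum>e\<in>Z. card e)"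
  proof (rule sum.cong)
    fix e assume e: "e \<in> Z"
    then have "?V \<inter> e = e" by blast
    then show "(\<Sum>x\<in>?V. if x \<in> e then 1 else 0) = card e"
      using fV by (simp add: sum.If_cases del: sum.insert Int_insert_left)
  qed simp
  also have "\<dots> = 2 * card Z" using two by simp
  finally have "even (\<Sum>x\<in>?V. card {e \<in> Z. x \<in> e})" by simp
  moreover have "(\<Sum>x\<in>?V. card {e \<in> Z. x \<in> e})
      = card {e \<in> Z. u \<in> e} + (\<Sum>x\<in>?V - {u}. card {e \<in> Z. x \<in> e})"
    using fV by (subst sum.remove[of _ u]) auto
  moreover have "even (\<Sum>x\<in>?V - {u}. card {e \<in> Z. x \<in> e})"
    by (rule dvd_sum) (use ev in blast)
  ultimately show ?thesis by simp
qed

text \<open>If \<open>f\<close> were not in \<open>C2\<close>, then \<open>u\<close> would be the only vertex of odd degree in \<open>C1 \<inter> C2\<close>. This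
  replaces following a two-colored path to its unique end.\<close>

lemma alternating_shared:
  assumes "finite E" and two: "\<forall>e\<in>E. card e = 2"
    and p1: "proper_edge_coloring E c1" and p2: "proper_edge_coloring E c2"
    and C1: "C1 \<subseteq> E" "alternating c1 a b C1" and C2: "C2 \<subseteq> E" "alternating c2 a' b' C2"
    and ab: "{a', b'} = {a, b}"
    and agree: "\<And>e. u \<notin> e \<Longrightarrow> c1 e = c2 e"
    and e: "e \<in> C1" "e \<in> C2" "u \<in> e" and f: "f \<in> C1" "u \<in> f"
  shows "f \<in> C2"
proof (rule ccontr)
  assume nf: "f \<notin> C2"
  let ?Z = "C1 \<inter> C2"
  have pair: "g = {u, x}" if "g \<in> E" "u \<in> g" "x \<in> g" "x \<noteq> u" for g x
  proof -
    obtain s t where "g = {s, t}" using two \<open>g \<in> E\<close> by (metis card_2_iff)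
    then show ?thesis using that by auto
  qed
  \<comment> \<open>Away from \<open>u\<close>, the intersection has degree 0 or 2: a common edge at
    \<open>x\<close> has the same partner there in both sets.\<close>
  have "even (card {h \<in> ?Z. x \<in> h})" if "x \<noteq> u" for x
  proof (cases "\<exists>e0. e0 \<in> ?Z \<and> x \<in> e0")
    case False
    then have "{h \<in> ?Z. x \<in> h} = {}" by blast
    then show ?thesis by (metis card.empty even_zero)
  next
    case True
    then obtain e0 where e0: "e0 \<in> C1" "e0 \<in> C2" "x \<in> e0" by blast
    obtain g1 where g1: "g1 \<in> C1" "g1 \<noteq> e0" "x \<in> g1" "c1 g1 \<noteq> c1 e0" "{a, b} = {c1 e0, c1 g1}"
      using alternating_other[OF p1 C1 e0(1,3)] by metis
    obtain g2 where g2: "g2 \<in> C2" "g2 \<noteq> e0" "x \<in> g2" "c2 g2 \<noteq> c2 e0" "{a', b'} = {c2 e0, c2 g2}"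
      using alternating_other[OF p2 C2 e0(2,3)] by metis
    have inE: "e0 \<in> E" "g1 \<in> E" "g2 \<in> E" using e0 g1 g2 C1 C2 by blast+
    have cols: "{c1 e0, c1 g1} = {c2 e0, c2 g2}" using g1(5) g2(5) ab by simp
    have "g1 = g2"
    proof (cases "u \<in> g1")
      case True
      then have "u \<notin> e0" using pair g1 e0 inE that by metis
      show ?thesis
      proof (cases "u \<in> g2")
        case True
        then show ?thesis using pair \<open>u \<in> g1\<close> g1 g2 inE that by metis
      next
        case False
        then have "c1 g2 = c1 g1" using agree[of g2] agree[OF \<open>u \<notin> e0\<close>] cols g1(4) g2(4)
          by (auto simp: doubleton_eq_iff)
        then show ?thesis using properD[OF p1, of g2 g1 x] inE g1 g2 by simp
      qed
    next
      case False
      then have c: "c2 g1 = c1 g1" using agree by simp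
      have "c2 g1 \<noteq> c2 e0" using properD[OF p2, of g1 e0 x] inE g1 e0 by blast
      then have "c2 g1 = c2 g2" using c cols by (auto simp: doubleton_eq_iff)
      then show ?thesis using properD[OF p2, of g1 g2 x] inE g1 g2 by simp
    qed
    then have "{h \<in> ?Z. x \<in> h} = {e0, g1}"
      using alternating_star[OF p1 C1 e0(1,3) g1(1,3,2)] e0 g1 g2 by blast
    then show ?thesis using g1(2) by simp
  qed
  then have "even (card {h \<in> ?Z. u \<in> h})"
    using even_degree_rest[of ?Z u] assms(1) two C1 C2
    by (metis (no_types, lifting) IntE finite_subset le_infI1 subset_iff)
  \<comment> \<open>At \<open>u\<close> the set \<open>C1\<close> has only the edges
    \<open>e\<close> and \<open>f\<close>; without \<open>f\<close> the common degree is 1.\<close>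
  moreover have "{h \<in> ?Z. u \<in> h} = {e}"
    using alternating_star[OF p1 C1 e(1,3) f(1,2)] e nf by blast
  ultimately show False by simp
qed

section \<open>Recoloring edges at one vertex\<close>

text \<open>All recolored edges pass through \<open>u\<close>, so a new conflict is either between
  two edges at \<open>u\<close> or between a recolored edge and an edge avoiding
  \<open>u\<close>.\<close>

lemma proper_recolor:
  assumes p: "proper_edge_coloring F c"
    and T: "\<And>e. e \<in> T \<Longrightarrow> u \<in> e" and F: "E - T \<subseteq> F"
    and same: "\<And>e. e \<in> E - T \<Longrightarrow> c' e = c e"
    and inj: "\<And>e f. e \<in> T \<Longrightarrow> f \<in> E \<Longrightarrow> u \<in> f \<Longrightarrow> f \<noteq> e \<Longrightarrow> c' e \<noteq> c' f"
    and far: "\<And>e f. e \<in> T \<Longrightarrow> e \<in> E \<Longrightarrow> f \<in> E \<Longrightarrow> u \<notin> f \<Longrightarrow> e \<inter> f \<noteq> {} \<Longrightarrow> c' e \<noteq> c' f"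
  shows "proper_edge_coloring E c'"
  unfolding proper_edge_coloring_def
proof (intro ballI impI)
  fix e f assume A: "e \<in> E" "f \<in> E" "e \<noteq> f \<and> e \<inter> f \<noteq> {}"
  have *: "c' e \<noteq> c' f" if "e \<in> T" "f \<in> E" "e \<in> E" "e \<noteq> f" "e \<inter> f \<noteq> {}" for e f
    using inj[of e f] far[of e f] that by blast
  show "c' e \<noteq> c' f"
  proof (cases "e \<in> T \<or> f \<in> T")
    case True
    then show ?thesis using *[of e f] *[of f e] A by (metis inf_commute)
  next
    case False
    then have "c' e = c e" "c' f = c f" "e \<in> F" "f \<in> F" using A same F by auto
    then show ?thesis using p A unfolding proper_edge_coloring_def by metis
  qed
qed

text \<open>A set without recolored edges would already be alternating for \<open>c\<close> inside
  \<open>F\<close>.\<close>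

lemma alternating_meets:
  assumes "alternating_free F c" "E - T \<subseteq> F" "\<And>e. e \<in> E - T \<Longrightarrow> c' e = c e"
    and "C \<subseteq> E" "alternating c' a b C"
  shows "\<exists>e\<in>C. e \<in> T"
proof (rule ccontr)
  assume "\<not> ?thesis"
  then have sub: "C \<subseteq> E - T" using assms(4) by blast
  then have "c' ` C = c ` C" using assms(3) by (metis image_cong subsetD)
  then have "alternating c a b C" using assms(5) unfolding alternating_def by simp
  then show False using assms(1,2) sub unfolding alternating_free_def by blast
qed

lemma alternating_freeI:
  assumes "proper_edge_coloring E c" "\<And>C a b. C \<subseteq> E \<Longrightarrow> alternating c a b C \<Longrightarrow> False"
  shows "alternating_free E c"
  using assms unfolding alternating_free_def by blast

lemma farD:
  assumes "far E u e g"
  shows "e \<in> E" "g \<in> E" "u \<in> e" "u \<notin> g" "e \<inter> g \<noteq> {}" "e \<noteq> g"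
  using assms unfolding far_def by auto

lemma far_unique:
  "far E u e g \<Longrightarrow> f \<in> E \<Longrightarrow> u \<notin> f \<Longrightarrow> e \<inter> f \<noteq> {} \<Longrightarrow> f = g"
  unfolding far_def by blast

section \<open>Edges of a sparse graph\<close>

text \<open>Degrees are bounded by \<open>k\<close> but need not attain it, so the class is closed
  under deleting an edge.\<close>

locale sparse_graph =
  fixes E :: "'a set set" and k :: nat
  assumes finite_edges: "finite E"
    and card_edge: "\<And>e. e \<in> E \<Longrightarrow> card e = 2"
    and degree_le: "\<And>v. degree E v \<le> k"
    and three_le: "3 \<le> k"
    and sparse: "\<And>u v. {u, v} \<in> E \<Longrightarrow> 3 \<le> degree E u \<Longrightarrow> degree E v \<le> 2"
begin

lemma edge_eq:
  assumes "e \<in> E" "u \<in> e" "y \<in> e" "y \<noteq> u"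
  shows "e = {u, y}"
proof -
  obtain s t where "e = {s, t}" using card_edge[OF assms(1)] card_2_iff by metis
  then show ?thesis using assms by auto
qed

lemma edge_ends:
  assumes "e \<in> E" "u \<in> e"
  obtains y where "y \<noteq> u" "e = {u, y}"
proof -
  obtain s t where "e = {s, t}" "s \<noteq> t" using card_edge[OF assms(1)] card_2_iff by metis
  then show ?thesis using that[of s] that[of t] assms by (cases "u = s") auto
qed

lemma far_or_leaf:
  assumes "e = {u, y}" "e \<in> E" "u \<noteq> y" "degree E y \<le> 2"
  shows "(\<forall>f\<in>E. u \<notin> f \<longrightarrow> e \<inter> f = {}) \<or> (\<exists>g. far E u e g)"
proof (cases "\<forall>f\<in>E. u \<notin> f \<longrightarrow> e \<inter> f = {}")
  case False
  then obtain g where g: "g \<in> E" "u \<notin> g" "e \<inter> g \<noteq> {}" by blast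
  then have y: "y \<in> g" using assms(1) by auto
  have "f = g" if f: "f \<in> E" "u \<notin> f" "e \<inter> f \<noteq> {}" for f
  proof (rule ccontr)
    assume "f \<noteq> g"
    moreover have "y \<in> f" using f assms(1) by auto
    moreover have "e \<noteq> f" "e \<noteq> g" using f g assms(1) by auto
    ultimately have "card {e, f, g} = 3" "{e, f, g} \<subseteq> {h \<in> E. y \<in> h}"
      using f g y assms(1,2) by auto
    then have "3 \<le> degree E y"
      unfolding degree_def using finite_edges card_mono[of "{h \<in> E. y \<in> h}" "{e, f, g}"] by simp
    then show False using assms(4) by simp
  qed
  then show ?thesis unfolding far_def using g assms(1,2) by blast
qed simp

lemma big_far_or_leaf:
  assumes "e \<in> E" "u \<in> e" "3 \<le> degree E u"
  shows "(\<forall>f\<in>E. u \<notin> f \<longrightarrow> e \<inter> f = {}) \<or> (\<exists>g. far E u e g)"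
proof -
  obtain y where y: "y \<noteq> u" "e = {u, y}" using edge_ends assms by metis
  then show ?thesis using far_or_leaf[of e u y] sparse[of u y] assms by auto
qed

text \<open>The other end of \<open>e\<close> needs a second edge of \<open>C\<close>, which cannot
  return to \<open>u\<close> in a simple graph.\<close>

lemma alternating_leaves:
  assumes "alternating c a b C" "C \<subseteq> E" "e \<in> C" "u \<in> e"
  obtains g where "g \<in> C" "u \<notin> g" "e \<inter> g \<noteq> {}"
proof -
  obtain y where y: "y \<noteq> u" "e = {u, y}" using edge_ends assms by (metis subsetD)
  then obtain g where g: "g \<in> C" "g \<noteq> e" "y \<in> g"
    using assms unfolding alternating_def by blast
  then have "u \<notin> g" using edge_eq[of g u y] y assms(2) by auto
  then show ?thesis using that g y by blast
qed

lemma alternating_far: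
  assumes "alternating c a b C" "C \<subseteq> E" "e \<in> C" "far E u e g"
  shows "g \<in> C"
proof -
  obtain h where "h \<in> C" "u \<notin> h" "e \<inter> h \<noteq> {}"
    using alternating_leaves[OF assms(1-3)] farD[OF assms(4)] by metis
  then show ?thesis using far_unique[OF assms(4)] assms(2) by blast
qed

text \<open>The path of two edges from \<open>u\<close> through a vertex of degree 2 is read from
  its other end \<open>x\<close>; a hole pushed along it is then seen from \<open>x\<close>.\<close>

lemma far_flip:
  assumes "far E u f h"
  obtains x where "x \<in> h" "x \<notin> f" "x \<noteq> u" "far E x h f"
proof -
  note F = farD[OF assms]
  obtain y where y: "y \<noteq> u" "f = {u, y}" using edge_ends F by metis
  then have "y \<in> h" using F(4,5) by auto
  then obtain x where x: "x \<noteq> y" "h = {y, x}" using edge_ends F by metis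
  have "x \<noteq> u" using x F(4) by auto
  have "q = f" if "q \<in> E" "x \<notin> q" "h \<inter> q \<noteq> {}" for q
  proof -
    have "y \<in> q" using that x by auto
    then show ?thesis
      using far_unique[OF assms, of q] that edge_eq[of q u y] y x by auto
  qed
  then have "far E x h f" unfolding far_def using x F(1,2) \<open>x \<noteq> u\<close> y by blast
  then show ?thesis using that x y \<open>x \<noteq> u\<close> by auto
qed

section \<open>Holes and the edges around them\<close>

text \<open>The edge \<open>e\<close> at \<open>u\<close> is the only uncolored edge; its continuation \<open>g\<close> has the color \<open>a\<close>,
  which is missing at \<open>u\<close>.\<close>

definition hole :: "('a set \<Rightarrow> nat) \<Rightarrow> 'a \<Rightarrow> 'a set \<Rightarrow> 'a set \<Rightarrow> nat \<Rightarrow> bool" where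
  "hole c u e g a \<longleftrightarrow> far E u e g \<and> alternating_free (E - {e}) c \<and> c ` (E - {e}) \<subseteq> {..<k} \<and> c g = a \<and>
     (\<forall>f\<in>E - {e}. u \<in> f \<longrightarrow> c f \<noteq> a)"

lemma holeD:
  assumes "hole c u e g a"
  shows "far E u e g" "alternating_free (E - {e}) c" "proper_edge_coloring (E - {e}) c"
    and "\<And>f. f \<in> E \<Longrightarrow> f \<noteq> e \<Longrightarrow> c f < k" "c g = a"
    "\<And>f. f \<in> E \<Longrightarrow> f \<noteq> e \<Longrightarrow> u \<in> f \<Longrightarrow> c f \<noteq> a"
proof -
  show "far E u e g" "alternating_free (E - {e}) c" "c g = a" using assms unfolding hole_def by blast+
  then show "proper_edge_coloring (E - {e}) c" unfolding alternating_free_def by blast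
  show "c f < k" if "f \<in> E" "f \<noteq> e" for f using assms that unfolding hole_def by blast
  show "c f \<noteq> a" if "f \<in> E" "f \<noteq> e" "u \<in> f" for f using assms that unfolding hole_def by blast
qed

lemma hole_color_lt: "hole c u e g a \<Longrightarrow> a < k"
  using holeD(1,4,5) farD by metis

lemma extend_proper:
  assumes "proper_edge_coloring (E - {e}) c" "u \<in> e"
    and "\<And>q. q \<in> E \<Longrightarrow> q \<noteq> e \<Longrightarrow> u \<in> q \<Longrightarrow> c q \<noteq> b"
    and "\<And>q. q \<in> E \<Longrightarrow> u \<notin> q \<Longrightarrow> e \<inter> q \<noteq> {} \<Longrightarrow> c q \<noteq> b"
  shows "proper_edge_coloring E (c(e := b))"
proof (rule proper_recolor[OF assms(1), of "{e}" u])
  show "(c(e := b)) e' \<noteq> (c(e := b)) q"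
    if "e' \<in> {e}" "q \<in> E" "u \<in> q" "q \<noteq> e'" for e' q
    using assms(3)[of q] that by auto
  show "(c(e := b)) e' \<noteq> (c(e := b)) q"
    if "e' \<in> {e}" "q \<in> E" "u \<notin> q" "e' \<inter> q \<noteq> {}" for e' q
    using assms(2) assms(4)[of q] that by auto
qed (use assms(2) in auto)

text \<open>A new alternating set would contain \<open>e\<close>, its continuation \<open>g\<close>,
  and a second edge at \<open>u\<close> in the color of \<open>g\<close>; \<open>ends\<close> denies
  it either \<open>g\<close> or that second edge.\<close>

lemma extend_uncritical:
  assumes gd: "alternating_free (E - {e}) c" and img: "c ` (E - {e}) \<subseteq> {..<k}" and e: "e \<in> E" "u \<in> e"
    and b: "b < k" "\<And>f. f \<in> E \<Longrightarrow> f \<noteq> e \<Longrightarrow> u \<in> f \<Longrightarrow> c f \<noteq> b"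
    and ends: "(\<forall>f\<in>E. u \<notin> f \<longrightarrow> e \<inter> f = {}) \<or>
      (\<exists>g. far E u e g \<and> c g \<noteq> b \<and> (\<forall>f\<in>E. f \<noteq> e \<and> u \<in> f \<longrightarrow> c f \<noteq> c g))"
  shows "colorable E k"
proof -
  let ?c = "c(e := b)"
  have p: "proper_edge_coloring (E - {e}) c" using gd unfolding alternating_free_def by blast
  have "c f \<noteq> b" if "f \<in> E" "u \<notin> f" "e \<inter> f \<noteq> {}" for f
    using ends that far_unique by metis
  then have p': "proper_edge_coloring E ?c" using extend_proper[OF p e(2) b(2)] by blast
  have "alternating_free E ?c"
  proof (rule alternating_freeI[OF p'])
    fix C x y assume C: "C \<subseteq> E" "alternating ?c x y C"
    have eC: "e \<in> C" using alternating_meets[OF gd, of E "{e}" ?c C] C by auto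
    obtain h where h: "h \<in> C" "u \<notin> h" "e \<inter> h \<noteq> {}"
      using alternating_leaves[OF C(2,1) eC e(2)] by metis
    then obtain g where g: "far E u e g" "c g \<noteq> b" "\<forall>f\<in>E. f \<noteq> e \<and> u \<in> f \<longrightarrow> c f \<noteq> c g"
      using ends C by blast
    have gC: "g \<in> C" "g \<noteq> e" using alternating_far[OF C(2,1) eC g(1)] farD(6)[OF g(1)] by auto
    obtain f where f: "f \<in> C" "f \<noteq> e" "u \<in> f" "?c f \<noteq> ?c e"
      using alternating_other[OF p' C eC e(2)] by metis
    have "c f = c g"
      using alternating_two_colors[OF C(2) f(1) eC gC(1) f(4)] f gC g by auto
    then show False using g f C by blast
  qed
  moreover have "?c ` E \<subseteq> {..<k}" using img b by auto
  ultimately show ?thesis unfolding colorable_def by blast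
qed

text \<open>A second color missing at \<open>u\<close> could be given to \<open>e\<close>, because
  the color \<open>a\<close> of the continuation \<open>g\<close> is missing at \<open>u\<close>
  too.\<close>

lemma hole_colors:
  assumes nc: "\<not> colorable E k" and h: "hole c u e g a" and b: "b < k" "b \<noteq> a"
  shows "\<exists>f\<in>E. f \<noteq> e \<and> u \<in> f \<and> c f = b"
proof (rule ccontr)
  assume "\<not> ?thesis"
  then have "colorable E k"
    using extend_uncritical[of e c u b] h b farD(1,3)[OF holeD(1)[OF h]]
    unfolding hole_def by blast
  then show False using nc by blast
qed

text \<open>The \<open>k - 1\<close> colors other than \<open>a\<close> all occur at
  \<open>u\<close> on edges other than \<open>e\<close>; with \<open>e\<close> this makes at least
  \<open>k\<close> edges.\<close>

lemma hole_degree: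
  assumes nc: "\<not> colorable E k" and h: "hole c u e g a"
  shows "3 \<le> degree E u"
proof -
  note F = farD[OF holeD(1)[OF h]]
  let ?S = "{f \<in> E. u \<in> f}"
  have fin: "finite ?S" using finite_edges by simp
  have "{..<k} - {a} \<subseteq> c ` (?S - {e})"
    using hole_colors[OF nc h] by blast
  then have "card ({..<k} - {a}) \<le> card (?S - {e})"
    using fin by (meson card_image_le card_mono finite_Diff finite_imageI le_trans)
  then have "k - 1 \<le> card ?S - 1"
    using fin F(1-3) hole_color_lt[OF h] by (simp add: card_Diff_singleton)
  moreover have "0 < card ?S" using fin F card_gt_0_iff by blast
  ultimately show ?thesis using three_le unfolding degree_def by linarith
qed

text \<open>\<open>e\<close> inherits the color of \<open>f\<close>, and \<open>f\<close> receives
  the color \<open>b\<close> missing at \<open>u\<close>. Conflicts at the far ends are excluded by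
  \<open>c g \<noteq> c f\<close> and \<open>ff\<close>.\<close>

lemma hole_swap_proper:
  assumes p: "proper_edge_coloring (E - {e}) c" and e: "far E u e g"
    and b: "\<And>q. q \<in> E \<Longrightarrow> q \<noteq> e \<Longrightarrow> u \<in> q \<Longrightarrow> c q \<noteq> b"
    and f: "f \<in> E" "f \<noteq> e" "u \<in> f" "c g \<noteq> c f"
    and ff: "\<And>q. q \<in> E \<Longrightarrow> u \<notin> q \<Longrightarrow> f \<inter> q \<noteq> {} \<Longrightarrow> c q \<noteq> b"
  shows "proper_edge_coloring E (c(e := c f, f := b))"
proof (rule proper_recolor[OF p, of "{e, f}" u])
  have cf: "c f \<noteq> c q" if "q \<in> E" "q \<noteq> e" "q \<noteq> f" "u \<in> q" for q
    using properD[OF p, of q f u] that f by (metis DiffI singletonD)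
  have b': "b \<noteq> c q" if "q \<in> E" "q \<noteq> e" "u \<in> q" for q
    using b that by metis
  show "(c(e := c f, f := b)) e' \<noteq> (c(e := c f, f := b)) q"
    if "e' \<in> {e, f}" "q \<in> E" "u \<in> q" "q \<noteq> e'" for e' q
    using that b'[of q] b[of f] cf[of q] f by auto
  have cg: "c q \<noteq> c f" if "q \<in> E" "u \<notin> q" "e \<inter> q \<noteq> {}" for q
    using far_unique[OF e] that f(4) by auto
  show "(c(e := c f, f := b)) e' \<noteq> (c(e := c f, f := b)) q"
    if "e' \<in> {e, f}" "q \<in> E" "u \<notin> q" "e' \<inter> q \<noteq> {}" for e' q
    proof -
    have "q \<noteq> e" "q \<noteq> f" using that(3) f(3) farD(3)[OF e] by auto
    moreover have "e' = f \<Longrightarrow> b \<noteq> c q" using ff that by metis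
    moreover have "e' = e \<Longrightarrow> c f \<noteq> c q" using cg that by metis
    ultimately show ?thesis using that(1) f(2) by auto
  qed
qed (use f farD(1,3)[OF e] in auto)

text \<open>If the first recoloring \<open>?c\<close> creates an alternating set \<open>C\<close>, then \<open>C\<close> leaves \<open>u\<close> through some \<open>z\<close>;
  the second recoloring \<open>?d\<close> gives \<open>z\<close> a color that does not occur in \<open>C\<close>.\<close>

lemma hole_spokes:
  assumes nc: "\<not> colorable E k" and h: "hole c u e g a" and f: "f \<in> E" "f \<noteq> e" "u \<in> f"
  shows "\<exists>h. far E u f h \<and> c h = a"
proof (rule ccontr)
  assume not: "\<not> ?thesis"
  note H = holeD[OF h]
  note F = farD[OF H(1)]
  have cinj: "c q \<noteq> c q'" if "q \<in> E" "q \<noteq> e" "q' \<in> E" "q' \<noteq> e" "q \<noteq> q'" "u \<in> q" "u \<in> q'" for q q'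
    using properD[OF H(3), of q q' u] that by blast
  have ge: "g \<noteq> e" "g \<noteq> f" using F(1-6) f by auto
  have cf: "c f \<noteq> a" "c f < k" using H f by auto
  let ?c = "c(e := c f, f := a)"
  have ff: "c q \<noteq> a" if "q \<in> E" "u \<notin> q" "f \<inter> q \<noteq> {}" for q
    using big_far_or_leaf[OF f(1,3) hole_degree[OF nc h]] not that far_unique by metis
  have p': "proper_edge_coloring E ?c"
    using hole_swap_proper[OF H(3,1) H(6) f _ ff] H(5) cf by simp
  have "?c ` E \<subseteq> {..<k}" using H(4) cf hole_color_lt[OF h] by auto
  then have "\<not> alternating_free E ?c" using nc unfolding colorable_def by blast
  then obtain C x y where C: "C \<subseteq> E" "alternating ?c x y C" using p' unfolding alternating_free_def by blast
  \<comment> \<open>A set through \<open>e\<close> and \<open>g\<close> has \<open>a\<close> as its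
    second color, so it leaves \<open>u\<close> through the edge of color \<open>a\<close>, which is
    \<open>f\<close>.\<close>
  have noe: "e \<notin> C'" if C': "C' \<subseteq> E" "alternating c' x y C'" "proper_edge_coloring E c'"
    "c' f = a" "c' g = a" "c' e \<noteq> a" "f \<notin> C'" for c' C' x y
  proof
    assume eC: "e \<in> C'"
    have gC: "g \<in> C'" using alternating_far[OF C'(2,1) eC H(1)] .
    obtain q where q: "q \<in> C'" "q \<noteq> e" "u \<in> q" "c' q \<noteq> c' e"
      using alternating_other[OF C'(3,1,2) eC F(3)] by metis
    have "c' q = a"
      using alternating_two_colors[OF C'(2) q(1) eC gC q(4)] C' by auto
    then have "q = f" using properD[OF C'(3), of q f u] q C' f by auto
    then show False using q C' by simp
  qed
  have fhd: "\<exists>d. far E u f d \<and> d \<in> C' \<and> c d \<noteq> c f \<and> c d \<noteq> a \<and> d \<noteq> e"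
    if C': "C' \<subseteq> E" "alternating c' x y C'" "f \<in> C'" for c' C' x y
  proof -
    obtain q where q: "q \<in> C'" "u \<notin> q" "f \<inter> q \<noteq> {}"
      using alternating_leaves[OF C'(2,1,3) f(3)] .
    then obtain d where d: "far E u f d" "d \<in> C'"
      using big_far_or_leaf[OF f(1,3) hole_degree[OF nc h]] alternating_far[OF C'(2,1,3)] C'(1)
      by blast
    note D = farD[OF d(1)]
    have "d \<noteq> e" using D F by auto
    moreover have "c d \<noteq> c f"
      using D F f \<open>d \<noteq> e\<close> H(3) unfolding proper_edge_coloring_def by blast
    ultimately show ?thesis using d not by blast
  qed
  have fC: "f \<in> C"
  proof (rule ccontr)
    assume "f \<notin> C"
    then have "e \<in> C" using alternating_meets[OF H(2), of E "{e, f}" ?c C] C by auto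
    then show False using noe[OF C p'] \<open>f \<notin> C\<close> H(5) ge cf f(2) by auto
  qed
  obtain d where d: "far E u f d" "d \<in> C" "c d \<noteq> c f" "c d \<noteq> a" "d \<noteq> e"
    using fhd[OF C fC] by blast
  have df: "d \<noteq> f" using farD[OF d(1)] by auto
  \<comment> \<open>\<open>e\<close>, \<open>f\<close> and \<open>d\<close> would carry three
    colors: \<open>c f\<close>, \<open>a\<close> and \<open>c d\<close>.\<close>
  have eC: "e \<notin> C"
  proof
    assume eC: "e \<in> C"
    then show False
      using alternating_two_colors[OF C(2) eC fC d(2)] d f cf df by auto
  qed
  obtain z where z: "z \<in> C" "z \<noteq> f" "u \<in> z" "?c z \<noteq> ?c f" "{x, y} = {?c f, ?c z}"
    using alternating_other[OF p' C fC f(3)] by metis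
  have zE: "z \<in> E" "z \<noteq> e" using z eC C by auto
  have cz: "c z = c d"
    using alternating_two_colors[OF C(2) fC z(1) d(2)] z zE d df by auto
  obtain t where t: "far E u z t" "t \<in> C"
  proof -
    obtain q where q: "q \<in> C" "u \<notin> q" "z \<inter> q \<noteq> {}" using alternating_leaves[OF C(2,1) z(1,3)] .
    then show ?thesis
      using that big_far_or_leaf[OF zE(1) z(3) hole_degree[OF nc h]] alternating_far[OF C(2,1) z(1)] C(1)
      by blast
  qed
  note T = farD[OF t(1)]
  have tt: "t \<noteq> e" "t \<noteq> f" "t \<noteq> z" using T F f by auto
  have ct: "c t = a"
  proof -
    have "c t \<noteq> c z"
      using T tt zE H(3) unfolding proper_edge_coloring_def by blast
    then show ?thesis
      using alternating_two_colors[OF C(2) fC z(1) t(2)] z zE tt by auto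
  qed
  \<comment> \<open>The colors move along three edges at \<open>u\<close>: \<open>e\<close> takes
    the color of \<open>z\<close>, which is \<open>c d\<close>, \<open>z\<close> that of
    \<open>f\<close>, and \<open>f\<close> the missing color \<open>a\<close>.\<close>
  let ?d = "c(e := c d, z := c f, f := a)"
  have czf: "c z \<noteq> c f" "c z \<noteq> a" using cz d by auto
  have far_e: "q = g" if "q \<in> E" "u \<notin> q" "e \<inter> q \<noteq> {}" for q using far_unique[OF H(1)] that by blast
  have far_z: "q = t" if "q \<in> E" "u \<notin> q" "z \<inter> q \<noteq> {}" for q using far_unique[OF t(1)] that by blast
  have far_f: "q = d" if "q \<in> E" "u \<notin> q" "f \<inter> q \<noteq> {}" for q using far_unique[OF d(1)] that by blast
  have zg: "z \<noteq> g" "z \<noteq> d" using F z farD[OF d(1)] by auto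
  have p'': "proper_edge_coloring E ?d"
  proof (rule proper_recolor[OF H(3), of "{e, f, z}" u])
    show "?d e' \<noteq> ?d q"
      if "e' \<in> {e, f, z}" "q \<in> E" "u \<in> q" "q \<noteq> e'" for e' q
    proof -
      have "a \<noteq> c q" if "q \<noteq> e" using H(6) that \<open>q \<in> E\<close> \<open>u \<in> q\<close> by metis
      moreover have "c f \<noteq> c q" if "q \<noteq> e" "q \<noteq> f"
        using cinj f that \<open>q \<in> E\<close> \<open>u \<in> q\<close> by metis
      moreover have "c z \<noteq> c q" if "q \<noteq> e" "q \<noteq> z"
        using cinj z zE that \<open>q \<in> E\<close> \<open>u \<in> q\<close> by metis
      ultimately show ?thesis
        using that(1,4) f(2) z(2) zE(2) cz[symmetric] czf not_sym[OF czf(1)] not_sym[OF czf(2)]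
          cf(1) not_sym[OF cf(1)] by auto
    qed
    show "?d e' \<noteq> ?d q"
      if "e' \<in> {e, f, z}" "q \<in> E" "u \<notin> q" "e' \<inter> q \<noteq> {}" for e' q
    proof -
      have "q \<noteq> e" "q \<noteq> f" "q \<noteq> z" using that(3) f(3) z(3) F(3) by auto
      moreover have "e' = e \<Longrightarrow> c d \<noteq> c q" using far_e that d(4) H(5) by metis
      moreover have "e' = f \<Longrightarrow> a \<noteq> c q" using far_f that d(4) by metis
      moreover have "e' = z \<Longrightarrow> c f \<noteq> c q" using far_z that ct cf(1) by metis
      ultimately show ?thesis using that(1) f(2) z(2) zE(2) by auto
    qed
  qed (use f F(3) z in auto)
  have "alternating_free E ?d"
  proof (rule alternating_freeI[OF p''])
    fix C' x' y' assume C': "C' \<subseteq> E" "alternating ?d x' y' C'"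
    have noz: "z \<notin> C'" if "f \<in> C'"
    proof
      assume "z \<in> C'"
      obtain d' where "far E u f d'" "d' \<in> C'" using fhd[OF C' \<open>f \<in> C'\<close>] by blast
      then have "d \<in> C'" using farD(2,4,5) far_f by metis
      then show False
        using alternating_two_colors[OF C'(2) \<open>z \<in> C'\<close> \<open>f \<in> C'\<close> \<open>d \<in> C'\<close>] z(2) d(3-5) df zg(2) cf(1)
        by simp
    qed
    \<comment> \<open>Without \<open>f\<close> the set would run through \<open>z\<close> and
      \<open>t\<close>, hence leave \<open>u\<close> in color \<open>a\<close>; but that edge is
      \<open>f\<close>.\<close>
    have fC': "f \<in> C'"
    proof (rule ccontr)
      assume nf: "f \<notin> C'"
      have "e \<notin> C'" using noe[OF C' p''] nf H(5) ge zg zE d f by auto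
      then have "z \<in> C'" using alternating_meets[OF H(2), of E "{e, f, z}" ?d C'] C' nf by auto
      have "t \<in> C'" using alternating_far[OF C'(2,1) \<open>z \<in> C'\<close> t(1)] .
      obtain q where q: "q \<in> C'" "q \<noteq> z" "u \<in> q" "?d q \<noteq> ?d z"
        using alternating_other[OF p'' C' \<open>z \<in> C'\<close> z(3)] by metis
      have "?d t = a" using ct tt by simp
      moreover have "?d z = c f" using z(2) by simp
      ultimately have "?d q = a"
        using alternating_two_colors[OF C'(2) q(1) \<open>z \<in> C'\<close> \<open>t \<in> C'\<close> q(4)] cf(1) by metis
      then have "q = f" using properD[OF p'', of q f u] q C' f by auto
      then show False using q nf by simp
    qed
    obtain d' where "far E u f d'" "d' \<in> C'" using fhd[OF C' fC'] by blast
    then have dC': "d \<in> C'" using farD(2,4,5) far_f by metis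
    have "{x', y'} = {a, c d}"
    proof -
      have "?d f \<in> {x', y'}" "?d d \<in> {x', y'}"
        using C' fC' dC' unfolding alternating_def by blast+
      then show ?thesis using d df zg by auto
    qed
    moreover have "{x, y} = {a, c d}" using z(5) cz z(2) zE by auto
    moreover have "?c q = ?d q" if "u \<notin> q" for q using that f(3) z(3) F(3) by auto
    \<comment> \<open>\<open>C\<close> and \<open>C'\<close> have the same two colors and share
      \<open>f\<close>, and their colorings agree away from \<open>u\<close>; parity puts the edge
      \<open>z\<close> of \<open>C\<close> into \<open>C'\<close>.\<close>
    ultimately have "z \<in> C'"
      using alternating_shared[OF finite_edges _ p' p'' C C', of u f z] card_edge fC fC' f(3) z(1,3)
      by metis
    then show False using noz fC' by blast
  qed
  moreover have "?d ` E \<subseteq> {..<k}"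
    using H(4) cf hole_color_lt[OF h] H(4)[of d] farD(2)[OF d(1)] d(5) by auto
  ultimately show False using nc unfolding colorable_def by blast
qed

text \<open>Moves the hole from \<open>e\<close> to the edge \<open>f\<close> at the same vertex.\<close>

lemma slide_hole:
  assumes F: "far E u e g" and gd: "alternating_free (E - {e}) c"
    and f: "f \<in> E" "f \<noteq> e" "u \<in> f" "c g \<noteq> c f"
    and stop: "\<And>q. q \<in> E \<Longrightarrow> q \<noteq> e \<Longrightarrow> u \<in> q \<Longrightarrow> c q = c g \<Longrightarrow>
        \<exists>t. far E u q t \<and> c t \<noteq> c f \<and> c t \<noteq> c g"
  shows "alternating_free (E - {f}) (c(e := c f))"
proof -
  have p: "proper_edge_coloring (E - {e}) c" using gd unfolding alternating_free_def by blast
  have p': "proper_edge_coloring (E - {f}) (c(e := c f))"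
  proof (rule proper_recolor[OF p, of "{e}" u])
    show "(c(e := c f)) e' \<noteq> (c(e := c f)) q"
      if "e' \<in> {e}" "q \<in> E - {f}" "u \<in> q" "q \<noteq> e'" for e' q
      using properD[OF p, of q f u] f that by auto
    show "(c(e := c f)) e' \<noteq> (c(e := c f)) q"
      if "e' \<in> {e}" "q \<in> E - {f}" "u \<notin> q" "e' \<inter> q \<noteq> {}" for e' q
      using far_unique[OF F, of q] farD(3)[OF F] f(4) that by auto
  qed (use farD(3)[OF F] in auto)
  show ?thesis
  proof (rule alternating_freeI[OF p'])
    fix C x y assume C: "C \<subseteq> E - {f}" "alternating (c(e := c f)) x y C"
    then have CE: "C \<subseteq> E" by blast
    have eC: "e \<in> C" using alternating_meets[OF gd, of "E - {f}" "{e}" "c(e := c f)" C] C by auto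
    have gC: "g \<in> C" "g \<noteq> e" using alternating_far[OF C(2) CE eC F] farD(6)[OF F] by auto
    obtain q where q: "q \<in> C" "q \<noteq> e" "u \<in> q" "(c(e := c f)) q \<noteq> (c(e := c f)) e"
      using alternating_other[OF p' C eC farD(3)[OF F]] by metis
    \<comment> \<open>Through \<open>e\<close> and \<open>g\<close> the set has the colors
      \<open>c f\<close> and \<open>c g\<close>, so it crosses \<open>u\<close> in color
      \<open>c g\<close>; \<open>stop\<close> then yields a third color.\<close>
    have "c q = c g"
      using alternating_two_colors[OF C(2) q(1) eC gC(1) q(4)] q(2) gC(2) f(4) by auto
    then obtain t where t: "far E u q t" "c t \<noteq> c f" "c t \<noteq> c g"
      using stop q CE by blast
    have tC: "t \<in> C" using alternating_far[OF C(2) CE q(1) t(1)] .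
    have "t \<noteq> e" using farD(4)[OF t(1)] farD(3)[OF F] by auto
    then show False
      using alternating_two_colors[OF C(2) gC(1) eC tC] gC(2) t(2,3) f(4) by simp
  qed
qed

section \<open>The walk of the hole\<close>

text \<open>The vertices that the hole has left so far: the edge of color \<open>a\<close> at each of them points one
  step forward along the walk, and the last one points back along the hole.\<close>

definition trail :: "'a set \<Rightarrow> ('a set \<Rightarrow> nat) \<Rightarrow> 'a \<Rightarrow> 'a set \<Rightarrow> nat \<Rightarrow> bool" where
  "trail A c u e a \<longleftrightarrow> A \<subseteq> \<Union> E \<and> u \<notin> A \<and>
    (\<forall>s\<in>A. 3 \<le> degree E s \<and> (\<exists>z z' b. z \<noteq> e \<and> c z = a \<and> far E s z z' \<and>
       b \<in> insert u A \<and> b \<in> z' \<and> b \<notin> z \<and> (b = u \<longrightarrow> z' = e)))"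

text \<open>For any other edge \<open>f\<close> at \<open>u\<close>, the continuation
  \<open>d\<close> has color \<open>a\<close> by \<open>hole_spokes\<close>. Now \<open>e\<close>
  takes the color of \<open>f\<close>, \<open>f\<close> takes \<open>a\<close>, and \<open>d\<close>
  is uncolored: the new hole is \<open>d\<close>, seen from its far end \<open>x\<close>, with
  continuation \<open>f\<close>.\<close>

lemma trail_step:
  assumes nc: "\<not> colorable E k" and h: "hole c u e g a" and tr: "trail A c u e a"
  shows "\<exists>c' x e' g'. hole c' x e' g' a \<and> trail (insert u A) c' x e' a"
proof -
  note H = holeD[OF h]
  note F = farD[OF H(1)]
  have "2 < card {q \<in> E. u \<in> q}" using hole_degree[OF nc h] unfolding degree_def by simp
  then have "\<not> {q \<in> E. u \<in> q} \<subseteq> {e}"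
    using card_mono[of "{e}" "{q \<in> E. u \<in> q}"] by auto
  then obtain f where f: "f \<in> E" "f \<noteq> e" "u \<in> f" by blast
  obtain d where d: "far E u f d" "c d = a" using hole_spokes[OF nc h f] by blast
  note D = farD[OF d(1)]
  obtain x where x: "x \<in> d" "x \<notin> f" "x \<noteq> u" "far E x d f" using far_flip[OF d(1)] .
  have de: "d \<noteq> e" "d \<noteq> f" using D(3,4) F(3) f(3) by auto
  have cf: "c f \<noteq> a" "c f < k" using H f by auto
  let ?s = "c(e := c f)"
  let ?c = "c(e := c f, f := a)"
  \<comment> \<open>The premise \<open>stop\<close> of \<open>slide_hole\<close> is vacuous: the
    color \<open>a\<close> of \<open>g\<close> is missing at \<open>u\<close>.\<close>
  have gs: "alternating_free (E - {f}) ?s"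
    by (rule slide_hole[OF H(1,2) f]) (use H(5,6) cf in auto)
  have p: "proper_edge_coloring (E - {d}) ?c"
  proof (rule proper_recolor[where F = "E - {f}" and c = ?s and T = "{f}" and u = u])
    show "proper_edge_coloring (E - {f}) ?s" using gs unfolding alternating_free_def by blast
    show "?c e' \<noteq> ?c q" if "e' \<in> {f}" "q \<in> E - {d}" "u \<in> q" "q \<noteq> e'" for e' q
      using that H(6)[of q] cf f(2) by auto
    show "?c e' \<noteq> ?c q" if "e' \<in> {f}" "q \<in> E - {d}" "u \<notin> q" "e' \<inter> q \<noteq> {}" for e' q
      using that far_unique[OF d(1), of q] by auto
  qed (use f in auto)
  have g': "alternating_free (E - {d}) ?c"
  proof (rule alternating_freeI[OF p])
    fix C x y assume C: "C \<subseteq> E - {d}" "alternating ?c x y C"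
    \<comment> \<open>Only \<open>f\<close> changes color after the slide, and an alternating set
      through \<open>f\<close> would need the uncolored edge \<open>d\<close>.\<close>
    have "f \<in> C" using alternating_meets[OF gs, of "E - {d}" "{f}" ?c C] C by auto
    then show False using alternating_far[OF C(2) _ _ d(1)] C(1) by blast
  qed
  \<comment> \<open>\<open>d\<close> was the only edge of color \<open>a\<close> at
    \<open>x\<close>; \<open>e\<close> gets another color, and \<open>f\<close> avoids
    \<open>x\<close>.\<close>
  have miss: "?c q \<noteq> a" if "q \<in> E - {d}" "x \<in> q" for q
  proof (cases "q = e")
    case False
    have "q \<noteq> f" using that x by auto
    moreover have "c q \<noteq> c d" using properD[OF H(3), of q d x] that x(1) False de D(2) by auto
    ultimately show ?thesis using False d by simp
  qed (use cf f in auto)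
  have img: "?c ` (E - {d}) \<subseteq> {..<k}" using H(4) cf hole_color_lt[OF h] by auto
  have "?c f = a" by simp
  then have hole': "hole ?c x d f a"
    unfolding hole_def using x(4) g' img miss by blast
  obtain y where y: "y \<noteq> u" "f = {u, y}" using edge_ends f by metis
  have yd: "y \<in> d" using D(4,5) y by auto
  have dxy: "d = {y, x}" using edge_eq[OF D(2) yd x(1)] x(2) y by auto
  have ydeg: "degree E y \<le> 2" using sparse[of u y] y f hole_degree[OF nc h] by auto
  \<comment> \<open>If \<open>d\<close> were the edge recorded for \<open>s\<close>, then
    \<open>s = x\<close>, as \<open>y\<close> has degree at most 2, and the continuation is
    \<open>f\<close>, ending at \<open>u\<close>. But a recorded continuation ending at
    \<open>u\<close> is \<open>e\<close>.\<close>
  have notd: "z \<noteq> d" if "s \<in> A" "far E s z z'" "b \<in> z'" "b \<notin> z" "b = u \<longrightarrow> z' = e" for s z z' b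
  proof
    assume z: "z = d"
    have "3 \<le> degree E s" using tr that(1) unfolding trail_def by blast
    then have "s \<noteq> y" using ydeg by auto
    then have "s = x" using farD(3)[OF that(2)] z dxy by auto
    then have "z' = f"
      using far_unique[OF x(4), of z'] that(2) farD(2,4,5)[OF that(2)] z by auto
    then have "b = u" using that(3,4) y yd z by auto
    then show False using that(5) \<open>z' = f\<close> f by simp
  qed
  \<comment> \<open>The edge of color \<open>a\<close> recorded for \<open>x\<close> would be
    \<open>d\<close> by properness. Hence the walk never returns.\<close>
  have xA: "x \<notin> A"
  proof
    assume "x \<in> A"
    then obtain z z' b where z: "z \<noteq> e" "c z = a" "far E x z z'" "b \<in> z'" "b \<notin> z" "b = u \<longrightarrow> z' = e"
      using tr unfolding trail_def by blast
    have "z = d" using properD[OF H(3), of z d x] z(1,2) d(2) x(1) de D(2) farD(1,3)[OF z(3)] by auto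
    then show False using notd[OF \<open>x \<in> A\<close> z(3-6)] by blast
  qed
  have "trail (insert u A) ?c x d a"
    unfolding trail_def
  proof (intro conjI ballI)
    show "insert u A \<subseteq> \<Union> E" using tr F unfolding trail_def by blast
    show "x \<notin> insert u A" using xA x by blast
    fix s assume s: "s \<in> insert u A"
    show "3 \<le> degree E s" using s tr hole_degree[OF nc h] unfolding trail_def by blast
    show "\<exists>z z' b. z \<noteq> d \<and> ?c z = a \<and> far E s z z' \<and> b \<in> insert x (insert u A) \<and> b \<in> z' \<and>
        b \<notin> z \<and> (b = x \<longrightarrow> z' = d)"
    proof (cases "s = u")
      case True
      have "f \<noteq> d \<and> ?c f = a \<and> far E s f d \<and> x \<in> insert x (insert u A) \<and> x \<in> d \<and> x \<notin> f \<and>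
        (x = x \<longrightarrow> d = d)" using True de d x by auto
      then show ?thesis by blast
    next
      case False
      then have sA: "s \<in> A" using s by blast
      then obtain z z' b where z: "z \<noteq> e" "c z = a" "far E s z z'" "b \<in> insert u A"
        "b \<in> z'" "b \<notin> z" "b = u \<longrightarrow> z' = e"
        using tr unfolding trail_def by blast
      have "z \<noteq> d" using notd[OF sA z(3,5-7)] .
      moreover have "?c z = a" using z(1,2) by simp
      moreover have "b \<noteq> x" using z(4) xA x(3) by auto
      ultimately show ?thesis using z(3-6) by blast
    qed
  qed
  then show ?thesis using hole' by blast
qed

text \<open>Each step adds a vertex to the trail, so there would be trails of every size inside the
  finite set \<open>\<Union> E\<close>.\<close>

lemma no_hole:
  assumes nc: "\<not> colorable E k" and h: "hole c u e g a"
  shows False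
proof -
  have "\<exists>c u e g A. hole c u e g a \<and> trail A c u e a \<and> card A = n" for n
  proof (induction n)
    case 0
    have "trail {} c u e a" unfolding trail_def by blast
    then show ?case using h card.empty by blast
  next
    case (Suc n)
    then obtain c u e g A where A: "hole c u e g a" "trail A c u e a" "card A = n" by blast
    then have "A \<subseteq> \<Union> E" "u \<notin> A" unfolding trail_def by blast+
    moreover have "finite (\<Union> E)"
      using finite_edges card_edge by (metis card.infinite finite_Union zero_neq_numeral)
    ultimately have "card (insert u A) = Suc n"
      using A(3) by (simp add: finite_subset)
    then show ?case using trail_step[OF nc A(1,2)] by blast
  qed
  then obtain c u e A where A: "trail A c u e a" "card A = Suc (card (\<Union> E))" by blast
  moreover have "finite (\<Union> E)"
    using finite_edges card_edge by (metis card.infinite finite_Union zero_neq_numeral)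
  ultimately have "card A \<le> card (\<Union> E)" unfolding trail_def by (meson card_mono)
  then show False using A by simp
qed

section \<open>Coloring an edge whose continuation has a color present at its end\<close>

lemma color_avoiding:
  assumes "finite S" "card S < k"
  obtains b where "b < k" "b \<notin> S"
proof -
  have "\<not> {..<k} \<subseteq> S" using card_mono[OF assms(1), of "{..<k}"] assms(2) by auto
  then show ?thesis using that by blast
qed

lemma card_star_less:
  assumes "e \<in> E" "u \<in> e" "degree E u \<le> Suc n"
  shows "card (c ` {q \<in> E. u \<in> q \<and> q \<noteq> e}) \<le> n"
proof -
  have "{q \<in> E. u \<in> q \<and> q \<noteq> e} = {q \<in> E. u \<in> q} - {e}" by blast
  then have "card {q \<in> E. u \<in> q \<and> q \<noteq> e} = degree E u - 1"
    unfolding degree_def using assms by (simp add: card_Diff_singleton)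
  moreover have "card (c ` {q \<in> E. u \<in> q \<and> q \<noteq> e}) \<le> card {q \<in> E. u \<in> q \<and> q \<noteq> e}"
    using finite_edges by (simp add: card_image_le)
  ultimately show ?thesis using assms(3) by simp
qed

lemma missing_color:
  assumes "e \<in> E" "u \<in> e"
  obtains b where "b < k" "\<And>q. q \<in> E \<Longrightarrow> q \<noteq> e \<Longrightarrow> u \<in> q \<Longrightarrow> c q \<noteq> b"
proof -
  have "card (c ` {q \<in> E. u \<in> q \<and> q \<noteq> e}) < k"
    using card_star_less[OF assms, of "k - 1" c] degree_le[of u] three_le by simp
  then obtain b where "b < k" "b \<notin> c ` {q \<in> E. u \<in> q \<and> q \<noteq> e}"
    using color_avoiding[of "c ` {q \<in> E. u \<in> q \<and> q \<noteq> e}"] finite_edges by auto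
  then show ?thesis using that by blast
qed

text \<open>Giving \<open>e\<close> a missing color \<open>b\<close> creates an alternating set
  \<open>B\<close> through \<open>p\<close> and \<open>g\<close>. No edge at \<open>u\<close> other
  than \<open>e\<close> and \<open>p\<close> has a continuation of color \<open>b\<close>, since
  sliding the uncolored edge there gives a \<open>hole\<close>. So when \<open>b\<close> goes to a
  third edge \<open>f\<close> and \<open>e\<close> takes the color of \<open>f\<close>, a new
  alternating set is forced to overlap \<open>B\<close>.\<close>

lemma extend_present:
  assumes nc: "\<not> colorable E k" and F0: "far E u e g" and gd: "alternating_free (E - {e}) c"
    and img: "c ` (E - {e}) \<subseteq> {..<k}" and big: "3 \<le> degree E u"
    and p: "p \<in> E" "p \<noteq> e" "u \<in> p" "c p = c g"
  shows False
proof -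
  note F = farD[OF F0]
  have pr: "proper_edge_coloring (E - {e}) c" using gd unfolding alternating_free_def by blast
  have cinj: "c q \<noteq> c q'" if "q \<in> E" "q \<noteq> e" "q' \<in> E" "q' \<noteq> e" "q \<noteq> q'" "q \<inter> q' \<noteq> {}" for q q'
    using pr that unfolding proper_edge_coloring_def by blast
  obtain b where b: "b < k" "\<And>q. q \<in> E \<Longrightarrow> q \<noteq> e \<Longrightarrow> u \<in> q \<Longrightarrow> c q \<noteq> b"
    using missing_color[OF F(1,3)] by metis
  have bg: "c g \<noteq> b" using b(2) p by metis
  have star: "q = p" if "q \<in> E" "q \<noteq> e" "u \<in> q" "c q = c g" for q
    using cinj p that by (metis IntI empty_iff)
  let ?b = "c(e := b)"
  have pb: "proper_edge_coloring E ?b"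
    by (rule extend_proper[OF pr F(3) b(2)]) (use far_unique[OF F0] bg in metis)+
  have "?b ` E \<subseteq> {..<k}" using img b by auto
  then have "\<not> alternating_free E ?b" using nc unfolding colorable_def by blast
  then obtain B x y where B: "B \<subseteq> E" "alternating ?b x y B" using pb unfolding alternating_free_def by blast
  have eB: "e \<in> B" using alternating_meets[OF gd, of E "{e}" ?b B] B by auto
  have gB: "g \<in> B" "g \<noteq> e" using alternating_far[OF B(2,1) eB F0] F(6) by auto
  have pB: "p \<in> B" "{x, y} = {b, c g}"
  proof -
    obtain q where q: "q \<in> B" "q \<noteq> e" "u \<in> q" "?b q \<noteq> ?b e" "{x, y} = {?b e, ?b q}"
      using alternating_other[OF pb B eB F(3)] by metis
    have "c q = c g"
      using alternating_two_colors[OF B(2) q(1) eB gB(1) q(4)] q(2) gB(2) bg by auto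
    then show "p \<in> B" "{x, y} = {b, c g}" using star q B by auto
  qed
  have far_in: "\<exists>t. far E u q t \<and> t \<in> C \<and> t \<noteq> e \<and> c t \<noteq> c q"
    if C: "C \<subseteq> E" "alternating c' x y C" "q \<in> C" "u \<in> q" "q \<noteq> e" for C c' x y q
  proof -
    obtain r where r: "r \<in> C" "u \<notin> r" "q \<inter> r \<noteq> {}" using alternating_leaves[OF C(2,1,3,4)] .
    have "q \<in> E" using C by blast
    then obtain t where t: "far E u q t"
      using big_far_or_leaf[OF _ C(4) big] r C(1) by blast
    note T = farD[OF t]
    have "t \<noteq> e" using T(4) F(3) by auto
    then show ?thesis
      using t alternating_far[OF C(2,1,3) t] cinj[of t q] T C(5) by (metis Int_commute)
  qed
  obtain t where t: "far E u p t" "t \<in> B" "t \<noteq> e" "c t \<noteq> c p" using far_in[OF B pB(1) p(3,2)] by blast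
  have ct: "c t = b" using alternating_two_colors[OF B(2) gB(1) eB t(2)] gB(2) t bg p(4) by auto
  have nofar: "c r \<noteq> b" if f: "f \<in> E" "f \<noteq> e" "u \<in> f" "f \<noteq> p" "far E u f r" for f r
  proof
    assume cr: "c r = b"
    have cgf: "c g \<noteq> c f" using star f by metis
    have "alternating_free (E - {f}) (c(e := c f))"
    proof (rule slide_hole[OF F0 gd f(1-3) cgf])
      \<comment> \<open>\<open>p\<close> is the only edge at \<open>u\<close> colored like
        \<open>g\<close>, and its continuation \<open>t\<close> has the third color
        \<open>b\<close>.\<close>
      fix q assume "q \<in> E" "q \<noteq> e" "u \<in> q" "c q = c g"
      then have "q = p" using star by blast
      then show "\<exists>t. far E u q t \<and> c t \<noteq> c f \<and> c t \<noteq> c g" using t(1) ct b(2) f bg by metis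
    qed
    moreover have "(c(e := c f)) ` (E - {f}) \<subseteq> {..<k}" using img f by auto
    moreover have "(c(e := c f)) r = b" using cr farD(4)[OF f(5)] F(3) by auto
    moreover have "\<forall>q\<in>E - {f}. u \<in> q \<longrightarrow> (c(e := c f)) q \<noteq> b" using b(2) f by auto
    ultimately have "hole (c(e := c f)) u f r b" unfolding hole_def using f(5) by blast
    then show False using no_hole[OF nc] by blast
  qed
  have "2 < card {q \<in> E. u \<in> q}" using big unfolding degree_def by simp
  moreover have "card {e, p} \<le> 2" by (simp add: card_insert_if)
  ultimately have "\<not> {q \<in> E. u \<in> q} \<subseteq> {e, p}"
    using card_mono[of "{e, p}" "{q \<in> E. u \<in> q}"] by auto
  then obtain f where f: "f \<in> E" "f \<noteq> e" "u \<in> f" "f \<noteq> p" by blast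
  have cf: "c f \<noteq> b" "c f < k" "c g \<noteq> c f" using b f img star by (blast, blast, metis)
  have ff: "c q \<noteq> b" if "q \<in> E" "u \<notin> q" "f \<inter> q \<noteq> {}" for q
    using big_far_or_leaf[OF f(1,3) big] that nofar[OF f] far_unique by metis
  let ?c = "c(e := c f, f := b)"
  have p': "proper_edge_coloring E ?c"
    by (rule hole_swap_proper[OF pr F0 b(2) f(1-3) cf(3) ff])
  have "alternating_free E ?c"
  proof (rule alternating_freeI[OF p'])
    fix C x' y' assume C: "C \<subseteq> E" "alternating ?c x' y' C"
    \<comment> \<open>Through \<open>e\<close> the set would contain \<open>g\<close>, then
      \<open>p\<close> at \<open>u\<close>, then \<open>t\<close>, with three colors
      \<open>c f\<close>, \<open>c g\<close> and \<open>b\<close>.\<close>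
    have noe: "e \<notin> C"
    proof
      assume eC: "e \<in> C"
      have gC: "g \<in> C" using alternating_far[OF C(2,1) eC F0] .
      have gf: "g \<noteq> f" using F(4) f(3) by auto
      obtain q where q: "q \<in> C" "q \<noteq> e" "u \<in> q" "?c q \<noteq> ?c e"
        using alternating_other[OF p' C eC F(3)] by metis
      have "?c q = c g"
        using alternating_two_colors[OF C(2) q(1) eC gC q(4)] gf gB(2) f(2) cf(3) by auto
      then have "q \<noteq> f" "c q = c g" using q(2) bg by (auto split: if_splits)
      then have "q = p" using star q C(1) by blast
      then have "t \<in> C" using alternating_far[OF C(2,1) q(1)] t(1) by blast
      have "t \<noteq> f" using farD(4)[OF t(1)] f(3) by auto
      then show False
        using alternating_two_colors[OF C(2) gC eC \<open>t \<in> C\<close>] gf gB(2) t(3) f(2) cf(1,3) bg ct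
        by (simp add: not_sym)
    qed
    have fC: "f \<in> C" using alternating_meets[OF gd, of E "{e, f}" ?c C] C noe by auto
    obtain r where r: "far E u f r" "r \<in> C" "r \<noteq> e" "c r \<noteq> c f" using far_in[OF C fC f(3,2)] by blast
    have rf: "r \<noteq> f" "c r \<noteq> b" using farD(6)[OF r(1)] nofar[OF f r(1)] by auto
    obtain q where q: "q \<in> C" "q \<noteq> f" "u \<in> q" "?c q \<noteq> ?c f" "{x', y'} = {?c f, ?c q}"
      using alternating_other[OF p' C fC f(3)] by metis
    have qe: "q \<noteq> e" "q \<in> E" using q noe C by auto
    obtain s where s: "far E u q s" "s \<in> C" "s \<noteq> e" "c s \<noteq> c q" using far_in[OF C q(1,3) qe(1)] by blast
    have "s \<noteq> f" using farD(4)[OF s(1)] f(3) by auto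
    \<comment> \<open>The set has the colors of \<open>f\<close> and \<open>q\<close>, so
      \<open>s\<close>, differing from \<open>q\<close>, shares the color \<open>b\<close> of
      \<open>f\<close>; by \<open>nofar\<close>, \<open>q\<close> can only be
      \<open>p\<close>.\<close>
    then have "c s = b"
      using alternating_two_colors[OF C(2) q(1) fC s(2) q(4)] s(3,4) qe(1) q(2) by auto
    then have qp: "q = p" using nofar[OF qe(2,1) q(3) _ s(1)] by blast
    then have "{x', y'} = {x, y}" using q(2,5) qe(1) pB(2) p(4) by auto
    moreover have "?b q = ?c q" if "u \<notin> q" for q using that f(3) F(3) by auto
    \<comment> \<open>\<open>B\<close> and \<open>C\<close> share \<open>p\<close> and both colors;
      parity forces the edge \<open>e\<close> of \<open>B\<close> into \<open>C\<close>.\<close>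
    ultimately have "e \<in> C"
      using alternating_shared[OF finite_edges _ pb p' B C, of u p e] card_edge pB(1) q(1) qp p(3) eB F(3)
      by metis
    then show False using noe by blast
  qed
  moreover have "?c ` E \<subseteq> {..<k}" using img b(1) cf(2) by auto
  ultimately show False using nc unfolding colorable_def by blast
qed

text \<open>At most two colors have to be avoided: that of the other edge at \<open>u\<close> and
  that of the edge beyond \<open>g\<close> at \<open>w\<close>. Avoiding the latter stops every
  alternating set at \<open>w\<close>.\<close>

lemma extend_small:
  assumes F0: "far E u e g" and gd: "alternating_free (E - {e}) c" and img: "c ` (E - {e}) \<subseteq> {..<k}"
    and small: "\<And>v. degree E v \<le> 2"
    and p: "p \<in> E" "p \<noteq> e" "u \<in> p" "c p = c g"
  shows "colorable E k"
proof -
  note F = farD[OF F0]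
  have pr: "proper_edge_coloring (E - {e}) c" using gd unfolding alternating_free_def by blast
  obtain w where w: "w \<in> g" "w \<notin> e" using far_flip[OF F0] .
  let ?S = "c ` {q \<in> E. u \<in> q \<and> q \<noteq> e} \<union> c ` {q \<in> E. w \<in> q \<and> q \<noteq> g}"
  have "card ?S \<le> 1 + 1"
    using card_Un_le card_star_less[OF F(1,3), of 1 c] card_star_less[OF F(2) w(1), of 1 c] small
    by (metis (no_types, lifting) Suc_1 add_mono le_trans One_nat_def)
  then have "card ?S < k" using three_le by simp
  then obtain b where b: "b < k" "b \<notin> ?S" using color_avoiding[of ?S] finite_edges by auto
  have bu: "c q \<noteq> b" if "q \<in> E" "q \<noteq> e" "u \<in> q" for q using b(2) that by auto
  \<comment> \<open>\<open>p\<close> has the color of \<open>g\<close>, so avoiding the colors at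
    \<open>u\<close> also separates \<open>e\<close> from \<open>g\<close>.\<close>
  then have bg: "c g \<noteq> b" using p by metis
  let ?b = "c(e := b)"
  have pb: "proper_edge_coloring E ?b"
    by (rule extend_proper[OF pr F(3) bu]) (use far_unique[OF F0] bg in metis)+
  have "alternating_free E ?b"
  proof (rule alternating_freeI[OF pb])
    fix B x y assume B: "B \<subseteq> E" "alternating ?b x y B"
    have eB: "e \<in> B" using alternating_meets[OF gd, of E "{e}" ?b B] B by auto
    have gB: "g \<in> B" using alternating_far[OF B(2,1) eB F0] .
    obtain r where r: "r \<in> B" "r \<noteq> g" "w \<in> r" "?b r \<noteq> ?b g"
      using alternating_other[OF pb B gB w(1)] by metis
    have re: "r \<noteq> e" using r w by auto
    then have "c r = b"
      using alternating_two_colors[OF B(2) r(1) gB eB r(4)] F(6) bg by auto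
    then show False using b(2) r B(1) by blast
  qed
  moreover have "?b ` E \<subseteq> {..<k}" using img b by auto
  ultimately show ?thesis unfolding colorable_def by blast
qed

section \<open>Induction on the number of edges\<close>

text \<open>By \<open>ch\<close>, the other end of \<open>e\<close> has degree at most 2. So
  \<open>e\<close> has no continuation, or one whose color is either present or missing at
  \<open>u\<close>.\<close>

lemma extend_coloring:
  assumes gd: "alternating_free (E - {e}) c" and img: "c ` (E - {e}) \<subseteq> {..<k}" and e: "e \<in> E" "u \<in> e"
    and ch: "3 \<le> degree E u \<or> (\<forall>v. degree E v \<le> 2)"
  shows "colorable E k"
proof (rule ccontr)
  assume nc: "\<not> colorable E k"
  obtain y where y: "y \<noteq> u" "e = {u, y}" using edge_ends e by metis
  have "degree E y \<le> 2" using ch sparse[of u y] e y by auto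
  then consider "\<forall>f\<in>E. u \<notin> f \<longrightarrow> e \<inter> f = {}" | g where "far E u e g"
    using far_or_leaf[OF y(2) e(1) not_sym[OF y(1)]] by blast
  then show False
  proof cases
    case 1
    obtain b where "b < k" "\<And>q. q \<in> E \<Longrightarrow> q \<noteq> e \<Longrightarrow> u \<in> q \<Longrightarrow> c q \<noteq> b"
      using missing_color[OF e] by metis
    then show False using extend_uncritical[OF gd img e, of b] 1 nc by blast
  next
    case 2
    show False
    proof (cases "\<exists>p\<in>E. p \<noteq> e \<and> u \<in> p \<and> c p = c g")
      case True
      then show False
        using extend_present[OF nc 2 gd img] extend_small[OF 2 gd img] nc ch by blast
    next
      case False
      then have "hole c u e g (c g)" unfolding hole_def using 2 gd img by blast
      then show False using no_hole[OF nc] by blast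
    qed
  qed
qed

lemma sparse_graph_remove: "sparse_graph (E - {e}) k"
proof
  have le: "degree (E - {e}) v \<le> degree E v" for v
    unfolding degree_def using finite_edges by (auto intro: card_mono)
  show "finite (E - {e})" using finite_edges by simp
  show "card f = 2" if "f \<in> E - {e}" for f using that card_edge by simp
  show "degree (E - {e}) v \<le> k" for v using le degree_le order_trans by blast
  show "3 \<le> k" by (rule three_le)
  show "degree (E - {e}) v \<le> 2" if "{u, v} \<in> E - {e}" "3 \<le> degree (E - {e}) u" for u v
    using sparse[of u v] le[of u] le[of v] that by auto
qed

end

theorem sparse_graph_colorable: "sparse_graph E k \<Longrightarrow> colorable E k"
proof (induction "card E" arbitrary: E rule: less_induct)
  case less
  interpret sparse_graph E k by fact
  show ?case
  proof (cases "E = {}")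
    case True
    then have "alternating_free E (\<lambda>_. 0)"
      unfolding alternating_free_def proper_edge_coloring_def alternating_def by blast
    then show ?thesis using True unfolding colorable_def by blast
  next
    case False
    obtain e u where e: "e \<in> E" "u \<in> e" "3 \<le> degree E u \<or> (\<forall>v. degree E v \<le> 2)"
    proof (cases "\<exists>u. 3 \<le> degree E u")
      case True
      then obtain u where u: "3 \<le> degree E u" by blast
      then have "card {e \<in> E. u \<in> e} \<noteq> 0" unfolding degree_def by simp
      then have "{e \<in> E. u \<in> e} \<noteq> {}" by (metis card.empty)
      then show ?thesis using that u by blast
    next
      case small: False
      obtain e where "e \<in> E" using False by blast
      moreover then obtain u where "u \<in> e" using card_edge by fastforce
      moreover have "degree E v \<le> 2" for v using small by (metis not_less_eq_eq numeral_2_eq_2 numeral_3_eq_3)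
      ultimately show ?thesis using that by blast
    qed
    have "card (E - {e}) < card E" using e finite_edges by (meson card_Diff1_less)
    then have "colorable (E - {e}) k" using less(1) sparse_graph_remove by blast
    then show ?thesis unfolding colorable_def[of "E - {e}"] using extend_coloring e by blast
  qed
qed

section \<open>From two-colored cycles to alternating sets\<close>

text \<open>The two cycle edges at a vertex differ since the length is at least 3, so each serves as
  the partner of the other.\<close>

lemma cycle_alternating:
  assumes cyc: "is_cycle E p" and two: "card (c ` cycle_edges p) \<le> 2"
  shows "\<exists>a b. alternating c a b (cycle_edges p)"
proof -
  let ?n = "length p" and ?C = "cycle_edges p"
  let ?e = "\<lambda>i. {p ! i, p ! (Suc i mod ?n)}"
  have n: "3 \<le> ?n" and d: "distinct p" using cyc unfolding is_cycle_def by blast+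
  have C: "?C = ?e ` {..<?n}" unfolding cycle_edges_def by blast
  have fin: "finite (c ` ?C)" and ne: "?C \<noteq> {}" using C n by (auto simp: lessThan_empty_iff)
  have "\<exists>a b. c ` ?C \<subseteq> {a, b}"
  proof (cases "card (c ` ?C) = 2")
    case True
    then show ?thesis by (metis card_2_iff order_refl)
  next
    case False
    then have "card (c ` ?C) = 1" using two fin ne by (cases "card (c ` ?C)") auto
    then show ?thesis by (metis card_1_singletonE insert_absorb2 order_refl)
  qed
  moreover have "\<exists>f\<in>?C. f \<noteq> e \<and> x \<in> f" if e: "e \<in> ?C" "x \<in> e" for e x
  proof -
    obtain i where i: "i < ?n" "e = ?e i" using e C by auto
    have next_ne: "?e i \<noteq> ?e (Suc i mod ?n)" if "i < ?n" for i
    proof -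
      have lt: "Suc i mod ?n < ?n" "Suc (Suc i mod ?n) mod ?n < ?n" using n by (auto intro!: mod_less_divisor)
      \<comment> \<open>Two steps lead back to the start only on a cycle of length at most
        2.\<close>
      have "Suc (Suc i mod ?n) mod ?n \<noteq> i" "i \<noteq> Suc i mod ?n"
        using n that by (auto simp: mod_Suc split: if_splits)
      then have "p ! i \<noteq> p ! (Suc i mod ?n)" "p ! i \<noteq> p ! (Suc (Suc i mod ?n) mod ?n)"
        using d that lt by (simp_all add: nth_eq_iff_index_eq)
      then show ?thesis by (auto simp: doubleton_eq_iff)
    qed
    consider "x = p ! (Suc i mod ?n)" | "x = p ! i" using e(2) i by auto
    then show ?thesis
    proof cases
      case 1
      have "Suc i mod ?n < ?n" using i(1) by (intro mod_less_divisor) linarith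
      then have "?e (Suc i mod ?n) \<in> ?C" using C by blast
      moreover have "?e (Suc i mod ?n) \<noteq> e" using next_ne[OF i(1)] i(2) by simp
      moreover have "x \<in> ?e (Suc i mod ?n)" using 1 by simp
      ultimately show ?thesis by (metis (no_types))
    next
      case 2
      let ?j = "if i = 0 then ?n - 1 else i - 1"
      have j: "?j < ?n" "Suc ?j mod ?n = i" using i(1) n by auto
      then have "?e ?j \<in> ?C" using C by blast
      moreover have "?e ?j \<noteq> e" using next_ne[OF j(1)] j(2) i(2) by metis
      moreover have "x \<in> ?e ?j" using 2 j(2) by simp
      ultimately show ?thesis by (metis (no_types))
    qed
  qed
  ultimately show ?thesis unfolding alternating_def using ne by blast
qed

lemma alternating_free_acyclic: "alternating_free E c \<Longrightarrow> acyclic_edge_coloring E c"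
  unfolding alternating_free_def acyclic_edge_coloring_def using cycle_alternating
  by (metis is_cycle_def)

section \<open>Upper and lower bound for the acyclic chromatic index\<close>

theorem theorem9:
  fixes V :: "'a set" and E :: "'a set set"
  assumes "finite_simple_graph V E"
    and "max_degree V E \<ge> 3"
    and "independent_set V E {v \<in> V. degree E v \<ge> 3}"
  shows "acyclic_chromatic_index E = max_degree V E"
proof -
  let ?k = "max_degree V E"
  have sub: "e \<subseteq> V" and c2: "card e = 2" if "e \<in> E" for e
    using assms(1) that unfolding finite_simple_graph_def by blast+
  have finV: "finite V" using assms(1) unfolding finite_simple_graph_def by blast
  have finE: "finite E" using finV sub by (meson Pow_iff finite_Pow_iff finite_subset subsetI)
  \<comment> \<open>\<open>max_degree\<close> ranges over \<open>V\<close> only, while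
    \<open>sparse_graph\<close> bounds the degree of every element of the type.\<close>
  have outside: "degree E v = 0" if "v \<notin> V" for v
  proof -
    have "{e \<in> E. v \<in> e} = {}" using sub that by blast
    then show ?thesis unfolding degree_def by (metis card.empty)
  qed
  have deg: "degree E v \<le> ?k" for v
  proof (cases "v \<in> V")
    case True
    then show ?thesis unfolding max_degree_def using finV by (intro Max_ge) auto
  qed (simp add: outside)
  have "sparse_graph E ?k"
  proof
    show "degree E v \<le> 2" if "{u, v} \<in> E" "3 \<le> degree E u" for u v
    proof (rule ccontr)
      assume "\<not> degree E v \<le> 2"
      then have "u \<in> {v \<in> V. degree E v \<ge> 3}" "v \<in> {v \<in> V. degree E v \<ge> 3}"
        using that sub by auto
      then show False using assms(3) that(1) unfolding independent_set_def by blast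
    qed
  qed (use finE c2 deg assms(2) in auto)
  then obtain c where c: "alternating_free E c" "c ` E \<subseteq> {..<?k}"
    using sparse_graph_colorable unfolding colorable_def by blast
  show ?thesis
    unfolding acyclic_chromatic_index_def
  proof (rule Least_equality)
    show "\<exists>c. acyclic_edge_coloring E c \<and> c ` E \<subseteq> {..<?k}" using c alternating_free_acyclic by blast
  next
    fix j assume "\<exists>c. acyclic_edge_coloring E c \<and> c ` E \<subseteq> {..<j}"
    then obtain c where p: "proper_edge_coloring E c" and img: "c ` E \<subseteq> {..<j}"
      unfolding acyclic_edge_coloring_def by blast
    have "?k \<in> insert 0 (degree E ` V)" unfolding max_degree_def using finV by (intro Max_in) auto
    then obtain v where v: "degree E v = ?k" using assms(2) by auto
    \<comment> \<open>Lower bound: the edges at a vertex of maximum degree need distinct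
      colors.\<close>
    have "inj_on c {e \<in> E. v \<in> e}" using properD[OF p] by (intro inj_onI) blast
    moreover have "c ` {e \<in> E. v \<in> e} \<subseteq> {..<j}" using img by blast
    ultimately have "card {e \<in> E. v \<in> e} \<le> card {..<j}" by (intro card_inj_on_le[of c]) auto
    then show "?k \<le> j" using v unfolding degree_def by simp
  qed
qed

end
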